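(* There exists a universal constant $C\in(0,\infty)$ such that for every $p\in[2,\infty)$, every integer $n\ge 2$ and every symmetric stochastic matrix $A\in M_n(\mathbb R)$ we have $$\gamma\big(A,\|\cdot\|_{\ell_p}^2\big)\le \frac{C\,p^2}{1-\lambda_2(A)} .$$
   Context: An $n\times n$ real matrix $A=(a_{ij})$ is symmetric stochastic if it is symmetric, has nonnegative entries, and each row sums to $1$; its eigenvalues in decreasing order are $1=\lambda_1(A)\ge\lambda_2(A)\ge\cdots\ge\lambda_n(A)$. The right hand side is interpreted as $\infty$ if $\lambda_2(A)=1$. $\gamma(A,\|\cdot\|_{\ell_p}^2)$ denotes the infimum over those $\gamma\in(0,\infty]$ such that for every $x_1,\ldots,x_n\in\ell_p$, $$\frac1{n^2}\sum_{i=1}^n\sum_{j=1}^n \|x_i-x_j\|_{\ell_p}^2\le \frac{\gamma}{n}\sum_{i=1}^n\sum_{j=1}^n a_{ij}\|x_i-x_j\|_{\ell_p}^2$$ ($\gamma=\infty$ is always admissible). *)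

theory Defs
  imports
    Complex_Main
    "HOL-Library.Extended_Real"
    "Jordan_Normal_Form.Char_Poly"
begin

definition symmetric_stochastic :: "real mat \<Rightarrow> bool" where
  "symmetric_stochastic A \<longleftrightarrow>
     square_mat A \<and>
     A\<^sup>T = A \<and>
     (\<forall>i < dim_row A. \<forall>j < dim_col A. A $$ (i, j) \<ge> 0) \<and>
     (\<forall>i < dim_row A. (\<Sum>j < dim_col A. A $$ (i, j)) = 1)"

text \<open>Each eigenvalue is repeated according to its multiplicity as a root of the characteristic
  polynomial. If the matrix is symmetric, this polynomial splits over the reals, so the list has as
  many entries as the matrix has rows, and the multiplicities are also the geometric ones.\<close>

definition eigenvalues_desc :: "real mat \<Rightarrow> real list" where
  "eigenvalues_desc A = rev (sorted_list_of_multiset (proots (char_poly A)))"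

text \<open>Indexed from 1. The value is meaningful only for symmetric matrices and
  \<open>1 \<le> k \<le> dim_row A\<close>.\<close>

definition nth_eigenvalue :: "nat \<Rightarrow> real mat \<Rightarrow> real" where
  "nth_eigenvalue k A = eigenvalues_desc A ! (k - 1)"

text \<open>The real sequence space $\ell_p$ with its norm, for $1 \le p < \infty$.\<close>

definition lp_space :: "real \<Rightarrow> (nat \<Rightarrow> real) set" where
  "lp_space p = {x. summable (\<lambda>k. \<bar>x k\<bar> powr p)}"

definition lp_norm :: "real \<Rightarrow> (nat \<Rightarrow> real) \<Rightarrow> real" where
  "lp_norm p x = (\<Sum>k. \<bar>x k\<bar> powr p) powr (1 / p)"

text \<open>The nonlinear spectral gap constant $\gamma(A, K)$ for a kernel \<open>K\<close> on a set \<open>X\<close>. Points are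
  indexed from 0. The value \<open>\<infinity>\<close> is inserted separately because it is admissible by convention, also
  when the right-hand sum vanishes.\<close>

definition poincare_const ::
    "real mat \<Rightarrow> 'b set \<Rightarrow> ('b \<Rightarrow> 'b \<Rightarrow> real) \<Rightarrow> ereal" where
  "poincare_const A X K = (let n = dim_row A in
     Inf (insert \<infinity> (ereal ` {g. 0 < g \<and>
       (\<forall>x :: nat \<Rightarrow> 'b. (\<forall>i < n. x i \<in> X) \<longrightarrow>
          1 / (real n)\<^sup>2 * (\<Sum>i < n. \<Sum>j < n. K (x i) (x j))
            \<le> g / real n * (\<Sum>i < n. \<Sum>j < n. A $$ (i, j) * K (x i) (x j)))})))"

definition gamma_lp_sq :: "real mat \<Rightarrow> real \<Rightarrow> ereal" where
  "gamma_lp_sq A p =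
     poincare_const A (lp_space p) (\<lambda>x y. (lp_norm p (\<lambda>k. x k - y k))\<^sup>2)"

end

theory Submission
  imports
    "HOL-Analysis.Brouwer_Fixpoint"
    "HOL-Analysis.Function_Metric"
    Defs
begin

text \<open>The Mazur map \<open>f\<close> from \<open>l\<^sub>p\<close> to \<open>l\<^sub>2\<close>, extended homogeneously, preserves norms and is
  \<open>O(p)\<close>-Lipschitz. Given finitely many points \<open>x\<^sub>i\<close>, truncated to finitely many coordinates, the
  Poincare-Miranda theorem yields a point \<open>z\<close> with \<open>\<Sum>\<^sub>i f (x\<^sub>i - z) = 0\<close>. The images
  \<open>y\<^sub>i = f (x\<^sub>i - z)\<close> then satisfy the Hilbert space spectral gap inequality with mean zero, so
  \<open>\<Sum>\<^sub>i |x\<^sub>i - z|\<^sup>2 = \<Sum>\<^sub>i |y\<^sub>i|\<^sup>2\<close> is at most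
  \<open>\<Sum>\<^sub>i\<^sub>j a\<^sub>i\<^sub>j |y\<^sub>i - y\<^sub>j|\<^sup>2 / (2 (1 - \<lambda>\<^sub>2))\<close>, hence at most
  \<open>O(p\<^sup>2 / (1 - \<lambda>\<^sub>2)) \<Sum>\<^sub>i\<^sub>j a\<^sub>i\<^sub>j |x\<^sub>i - x\<^sub>j|\<^sup>2\<close>; the triangle inequality through \<open>z\<close> concludes.
  The Hilbert space inequality needs no full spectral theorem: a maximiser of the quadratic form of
  \<open>A\<close> on the unit vectors orthogonal to the constants is an eigenvector, whose eigenvalue \<open>\<mu>\<close>
  occurs in the spectrum in addition to the eigenvalue 1 of the constants, so \<open>\<mu> \<le> \<lambda>\<^sub>2\<close>.\<close>

section \<open>The Poincare-Miranda theorem\<close>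

text \<open>Tychonoff's theorem, in the form needed for cubes and spheres of vectors that are
  represented as functions on \<open>nat\<close>.\<close>

lemma compact_PiE_UNIV:
  fixes S :: "'i \<Rightarrow> 'a::topological_space set"
  assumes "\<And>i. compact (S i)"
  shows "compact (PiE UNIV S)"
  using compactin_PiE[of "\<lambda>_. euclidean :: 'a topology" UNIV S] assms
  by (auto simp: euclidean_product_topology)

text \<open>Kuhn's combinatorial lemma on ever finer grids gives small cells in which every
  coordinate of \<open>h\<close> takes both signs at corners. By compactness the cells accumulate at
  one point, where continuity forces every coordinate to vanish. Functions on \<open>nat\<close>
  stand for vectors of length \<open>N\<close>, so continuity refers to the first \<open>N\<close>
  coordinates only.\<close>

lemma Poincare_Miranda:
  fixes h :: "(nat \<Rightarrow> real) \<Rightarrow> nat \<Rightarrow> real"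
  assumes R: "R > 0"
    and cont: "\<And>\<zeta> z k. k < N \<Longrightarrow> (\<And>j. j < N \<Longrightarrow> (\<lambda>m. \<zeta> m j) \<longlonglongrightarrow> z j) \<Longrightarrow> (\<lambda>m. h (\<zeta> m) k) \<longlonglongrightarrow> h z k"
    and lower: "\<And>z k. k < N \<Longrightarrow> (\<And>j. j < N \<Longrightarrow> \<bar>z j\<bar> \<le> R) \<Longrightarrow> z k = - R \<Longrightarrow> h z k \<ge> 0"
    and upper: "\<And>z k. k < N \<Longrightarrow> (\<And>j. j < N \<Longrightarrow> \<bar>z j\<bar> \<le> R) \<Longrightarrow> z k = R \<Longrightarrow> h z k \<le> 0"
  obtains z where "\<And>k. k < N \<Longrightarrow> h z k = 0"
proof -
  \<comment> \<open>The lattice \<open>{0..Suc m}\<close> is mapped affinely onto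
    \<open>{- R..R}\<close> in each coordinate. The default 0 beyond \<open>N\<close> keeps all grid
    points in one compact cube.\<close>
  define grid where "grid m x j = (if j < N then R * (2 * real (x j) / real (Suc m) - 1) else 0)"
    for m :: nat and x :: "nat \<Rightarrow> nat" and j
  have grid_bound: "\<bar>grid m x j\<bar> \<le> R" if "\<forall>j<N. x j \<le> Suc m" for m x j
  proof (cases "j < N")
    case True
    with that have "real (x j) \<le> real (Suc m)" by (simp only: of_nat_le_iff)
    then have "2 * real (x j) / real (Suc m) \<le> 2" by (subst pos_divide_le_eq) auto
    then have "\<bar>2 * real (x j) / real (Suc m) - 1\<bar> \<le> 1" by (simp add: abs_le_iff)
    then have "R * \<bar>2 * real (x j) / real (Suc m) - 1\<bar> \<le> R * 1" using R by (intro mult_left_mono) auto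
    then show ?thesis using True R by (simp add: grid_def abs_mult)
  qed (use R in \<open>simp add: grid_def\<close>)
  have cell: "\<exists>q. (\<forall>k<N. q k < Suc m) \<and> (\<forall>k<N. \<exists>r s.
      (\<forall>j<N. q j \<le> r j \<and> r j \<le> q j + 1) \<and> (\<forall>j<N. q j \<le> s j \<and> s j \<le> q j + 1) \<and>
      h (grid m r) k \<ge> 0 \<and> h (grid m s) k \<le> 0)" for m
  proof -
    \<comment> \<open>Kuhn's lemma prescribes the labels on the two boundary faces. The hypotheses
      \<open>lower\<close> and \<open>upper\<close> make these forced labels agree with the sign of
      \<open>h\<close>.\<close>
    define label where "label x k = (if x k = Suc m then 1 else if x k = 0 then 0
      else if h (grid m x) k \<ge> 0 then 0 else (1::nat))" for x :: "nat \<Rightarrow> nat" and k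
    obtain q where q: "\<forall>k<N. q k < Suc m" and rs: "\<forall>k<N. \<exists>r s.
      (\<forall>j<N. q j \<le> r j \<and> r j \<le> q j + 1) \<and> (\<forall>j<N. q j \<le> s j \<and> s j \<le> q j + 1) \<and> label r k \<noteq> label s k"
      by (rule kuhn_lemma[of "Suc m" N label]) (auto simp: label_def)
    have label0: "h (grid m x) k \<ge> 0" if "k < N" "\<forall>j<N. x j \<le> Suc m" "label x k = 0" for x k
    proof -
      have "x k = 0 \<Longrightarrow> grid m x k = - R" using that(1) by (simp add: grid_def del: of_nat_Suc)
      then show ?thesis
        using that lower[of k "grid m x", OF that(1) grid_bound[OF that(2)]]
        by (auto simp: label_def split: if_splits)
    qed
    have label1: "h (grid m x) k \<le> 0" if "k < N" "\<forall>j<N. x j \<le> Suc m" "label x k \<noteq> 0" for x k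
    proof -
      have "x k = Suc m \<Longrightarrow> grid m x k = R" using that(1) by (simp add: grid_def del: of_nat_Suc)
      then show ?thesis
        using that upper[of k "grid m x", OF that(1) grid_bound[OF that(2)]]
        by (auto simp: label_def split: if_splits)
    qed
    have "\<exists>r s. (\<forall>j<N. q j \<le> r j \<and> r j \<le> q j + 1) \<and> (\<forall>j<N. q j \<le> s j \<and> s j \<le> q j + 1) \<and>
      h (grid m r) k \<ge> 0 \<and> h (grid m s) k \<le> 0" if k: "k < N" for k
    proof -
      obtain r s where r: "\<forall>j<N. q j \<le> r j \<and> r j \<le> q j + 1"
        and s: "\<forall>j<N. q j \<le> s j \<and> s j \<le> q j + 1" and neq: "label r k \<noteq> label s k"
        using rs k by blast
      have bounds: "\<forall>j<N. r j \<le> Suc m" "\<forall>j<N. s j \<le> Suc m"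
        using q r s by (metis Suc_eq_plus1 Suc_leI le_trans not_less_eq_eq)+
      consider "label r k = 0" "label s k \<noteq> 0" | "label s k = 0" "label r k \<noteq> 0"
        using neq by (auto simp: label_def split: if_splits)
      then show ?thesis
      proof cases
        case 1
        then have "h (grid m r) k \<ge> 0 \<and> h (grid m s) k \<le> 0" using label0 label1 k bounds by simp
        with r s show ?thesis by (intro exI[of _ r] exI[of _ s] conjI) simp_all
      next
        case 2
        then have "h (grid m s) k \<ge> 0 \<and> h (grid m r) k \<le> 0" using label0 label1 k bounds by simp
        with r s show ?thesis by (intro exI[of _ s] exI[of _ r] conjI) simp_all
      qed
    qed
    with q show ?thesis by blast
  qed
  obtain q where q: "\<And>m. \<forall>k<N. q m k < Suc m"
    and q_rs: "\<And>m. \<forall>k<N. \<exists>r s.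
      (\<forall>j<N. q m j \<le> r j \<and> r j \<le> q m j + 1) \<and> (\<forall>j<N. q m j \<le> s j \<and> s j \<le> q m j + 1) \<and>
      h (grid m r) k \<ge> 0 \<and> h (grid m s) k \<le> 0"
    using cell by metis
  have cube: "compact (PiE UNIV (\<lambda>j. {- R..R}) :: (nat \<Rightarrow> real) set)"
    by (intro compact_PiE_UNIV) auto
  have in_cube: "grid m (q m) \<in> PiE UNIV (\<lambda>j. {- R..R})" for m
  proof -
    have "\<forall>j<N. q m j \<le> Suc m" using q by (meson less_imp_le)
    then have "\<bar>grid m (q m) j\<bar> \<le> R" for j by (rule grid_bound)
    then show ?thesis by (auto simp: abs_le_iff minus_le_iff)
  qed
  obtain z \<sigma> where \<sigma>: "strict_mono \<sigma>" and lim: "((\<lambda>m. grid m (q m)) \<circ> \<sigma>) \<longlonglongrightarrow> z"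
    using cube[unfolded compact_def, rule_format, of "\<lambda>m. grid m (q m)"] in_cube by blast
  have limj: "(\<lambda>m. grid (\<sigma> m) (q (\<sigma> m)) j) \<longlonglongrightarrow> z j" for j
    using continuous_on_tendsto_compose[OF continuous_on_product_coordinates[of j] lim] by (simp add: o_def)
  have mesh: "(\<lambda>m. 2 * R / real (Suc (\<sigma> m))) \<longlonglongrightarrow> 0"
    using LIMSEQ_subseq_LIMSEQ[OF tendsto_mult[OF tendsto_const[of "2 * R"] LIMSEQ_inverse_real_of_nat] \<sigma>]
    by (simp add: o_def field_simps)
  \<comment> \<open>Corners of a cell differ from \<open>q\<close> by at most one lattice step,
    hence by at most the mesh, so every choice of corners has the same limit.\<close>
  have corner: "(\<lambda>m. grid (\<sigma> m) (r m) j) \<longlonglongrightarrow> z j"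
    if r: "\<And>m. \<forall>j<N. q (\<sigma> m) j \<le> r m j \<and> r m j \<le> q (\<sigma> m) j + 1" and j: "j < N" for r j
  proof -
    have "(\<lambda>m. grid (\<sigma> m) (r m) j - grid (\<sigma> m) (q (\<sigma> m)) j) \<longlonglongrightarrow> 0"
    proof (rule Lim_null_comparison[OF _ mesh], rule always_eventually, rule allI)
      fix m
      have "grid (\<sigma> m) (r m) j - grid (\<sigma> m) (q (\<sigma> m)) j
          = 2 * R / real (Suc (\<sigma> m)) * (real (r m j) - real (q (\<sigma> m) j))"
        using j by (simp add: grid_def right_diff_distrib diff_divide_distrib mult_ac del: of_nat_Suc)
      also have "\<bar>\<dots>\<bar> \<le> 2 * R / real (Suc (\<sigma> m)) * 1"
        unfolding abs_mult using r[of m] j R by (intro mult_mono) auto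
      finally show "norm (grid (\<sigma> m) (r m) j - grid (\<sigma> m) (q (\<sigma> m)) j) \<le> 2 * R / real (Suc (\<sigma> m))"
        by simp
    qed
    from tendsto_add[OF this limj[of j]] show ?thesis by simp
  qed
  \<comment> \<open>The corners that witness the two signs depend on \<open>k\<close>, but both
    sequences converge to the same \<open>z\<close>.\<close>
  have "h z k = 0" if k: "k < N" for k
  proof -
    have "\<forall>m. \<exists>r. (\<forall>j<N. q (\<sigma> m) j \<le> r j \<and> r j \<le> q (\<sigma> m) j + 1) \<and> h (grid (\<sigma> m) r) k \<ge> 0"
      using q_rs k by blast
    from choice[OF this] obtain r where
      r: "\<And>m. \<forall>j<N. q (\<sigma> m) j \<le> r m j \<and> r m j \<le> q (\<sigma> m) j + 1"
      and hr: "\<And>m. h (grid (\<sigma> m) (r m)) k \<ge> 0"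
      by blast
    have "\<forall>m. \<exists>s. (\<forall>j<N. q (\<sigma> m) j \<le> s j \<and> s j \<le> q (\<sigma> m) j + 1) \<and> h (grid (\<sigma> m) s) k \<le> 0"
      using q_rs k by blast
    from choice[OF this] obtain s where
      s: "\<And>m. \<forall>j<N. q (\<sigma> m) j \<le> s m j \<and> s m j \<le> q (\<sigma> m) j + 1"
      and hs: "\<And>m. h (grid (\<sigma> m) (s m)) k \<le> 0"
      by blast
    have "(\<lambda>m. h (grid (\<sigma> m) (r m)) k) \<longlonglongrightarrow> h z k" using corner[OF r] by (intro cont[OF k])
    then have "h z k \<ge> 0" using hr by (intro LIMSEQ_le_const) auto
    have "(\<lambda>m. h (grid (\<sigma> m) (s m)) k) \<longlonglongrightarrow> h z k" using corner[OF s] by (intro cont[OF k])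
    then have "h z k \<le> 0" using hs by (intro LIMSEQ_le_const2) auto
    then show ?thesis using \<open>h z k \<ge> 0\<close> by simp
  qed
  then show ?thesis using that by blast
qed

section \<open>The Mazur map\<close>

text \<open>Truncating keeps vectors in sequence space while making the problem finite-dimensional;
  the full norm returns as the limit in \<open>N\<close>.\<close>

definition lp_norm_upto :: "real \<Rightarrow> nat \<Rightarrow> (nat \<Rightarrow> real) \<Rightarrow> real" where
  "lp_norm_upto p N x = (\<Sum>k<N. \<bar>x k\<bar> powr p) powr (1 / p)"

lemma lp_norm_upto_nonneg [simp]: "0 \<le> lp_norm_upto p N x"
  by (simp add: lp_norm_upto_def)

lemma lp_norm_upto_powr:
  assumes "p > 0"
  shows "lp_norm_upto p N x powr p = (\<Sum>k<N. \<bar>x k\<bar> powr p)"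
  using assms by (simp add: lp_norm_upto_def powr_powr sum_nonneg)

lemma lp_norm_upto_eq_0_iff:
  assumes "p > 0"
  shows "lp_norm_upto p N x = 0 \<longleftrightarrow> (\<forall>k<N. x k = 0)"
  using assms by (auto simp: lp_norm_upto_def sum_nonneg_eq_0_iff)

lemma lp_norm_upto_minus_commute:
  "lp_norm_upto p N (\<lambda>k. x k - y k) = lp_norm_upto p N (\<lambda>k. y k - x k)"
  by (simp add: lp_norm_upto_def abs_minus_commute)

text \<open>Convexity of the power on positive reals; a zero argument is handled by
  \<open>w powr p \<le> w\<close> for \<open>w\<close> between 0 and 1.\<close>

lemma powr_convex_combination:
  fixes s t u v p :: real
  assumes "p \<ge> 1" "s \<ge> 0" "t \<ge> 0" "u \<ge> 0" "v \<ge> 0" "u + v = 1"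
  shows "(u * s + v * t) powr p \<le> u * s powr p + v * t powr p"
proof -
  have scale: "(w * z) powr p \<le> w * z powr p" if "0 \<le> w" "w \<le> 1" "0 \<le> z" for w z :: real
  proof -
    have "w powr p \<le> w powr 1"
      using that assms(1) by (intro powr_mono') auto
    then show ?thesis using that by (auto simp: powr_mult intro: mult_right_mono)
  qed
  show ?thesis
  proof (cases "s = 0 \<or> t = 0")
    case True
    then show ?thesis using scale[of u s] scale[of v t] assms by auto
  next
    case False
    with assms have "s > 0" "t > 0" by auto
    then show ?thesis
      using convex_onD[OF powr_convex[OF assms(1)], of v s t] assms
      by (auto simp: eq_diff_eq[symmetric])
  qed
qed

text \<open>Minkowski's inequality: \<open>x / a\<close> and \<open>y / b\<close> have norm 1, and
  convexity with weights \<open>a / (a + b)\<close> and \<open>b / (a + b)\<close> is summed over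
  the coordinates.\<close>

lemma lp_norm_upto_triangle:
  assumes "p \<ge> 1"
  shows "lp_norm_upto p N (\<lambda>k. x k + y k) \<le> lp_norm_upto p N x + lp_norm_upto p N y"
proof -
  define a where "a = lp_norm_upto p N x"
  define b where "b = lp_norm_upto p N y"
  have p: "p > 0" using assms by simp
  have ab: "a \<ge> 0" "b \<ge> 0" by (auto simp: a_def b_def)
  consider "a = 0" | "b = 0" | "a > 0" "b > 0" using ab by linarith
  then show ?thesis
  proof cases
    case 1
    then have "\<forall>k<N. x k = 0" using lp_norm_upto_eq_0_iff[OF p] by (simp add: a_def)
    then show ?thesis by (simp add: lp_norm_upto_def)
  next
    case 2
    then have "\<forall>k<N. y k = 0" using lp_norm_upto_eq_0_iff[OF p] by (simp add: b_def)
    then show ?thesis by (simp add: lp_norm_upto_def)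
  next
    case 3
    have pointwise: "\<bar>x k + y k\<bar> powr p \<le> (a + b) powr p *
        (a / (a + b) * (\<bar>x k\<bar> powr p / a powr p) + b / (a + b) * (\<bar>y k\<bar> powr p / b powr p))" for k
    proof -
      have "\<bar>x k + y k\<bar> powr p \<le> ((a + b) * (a / (a + b) * (\<bar>x k\<bar> / a) + b / (a + b) * (\<bar>y k\<bar> / b))) powr p"
        using 3 p abs_triangle_ineq[of "x k" "y k"] by (intro powr_mono2) (simp_all add: distrib_left)
      also have "\<dots> = (a + b) powr p * (a / (a + b) * (\<bar>x k\<bar> / a) + b / (a + b) * (\<bar>y k\<bar> / b)) powr p"
        using 3 by (intro powr_mult)
      also have "\<dots> \<le> (a + b) powr p * (a / (a + b) * (\<bar>x k\<bar> / a) powr p + b / (a + b) * (\<bar>y k\<bar> / b) powr p)"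
        using 3 assms by (intro mult_left_mono powr_convex_combination) (auto simp flip: add_divide_distrib)
      finally show ?thesis using 3 by (simp add: powr_divide)
    qed
    have "(\<Sum>k<N. \<bar>x k + y k\<bar> powr p) \<le> (\<Sum>k<N. (a + b) powr p *
        (a / (a + b) * (\<bar>x k\<bar> powr p / a powr p) + b / (a + b) * (\<bar>y k\<bar> powr p / b powr p)))"
      by (intro sum_mono pointwise)
    also have "\<dots> = (a + b) powr p * (a / (a + b) * ((\<Sum>k<N. \<bar>x k\<bar> powr p) / a powr p)
         + b / (a + b) * ((\<Sum>k<N. \<bar>y k\<bar> powr p) / b powr p))"
      by (simp only: sum_distrib_left sum.distrib sum_divide_distrib distrib_left)
    also have "\<dots> = (a + b) powr p * (a / (a + b) + b / (a + b))"
      using 3 p by (simp add: a_def b_def flip: lp_norm_upto_powr)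
    also have "\<dots> = (a + b) powr p"
      using 3 by (simp flip: add_divide_distrib)
    finally have "(\<Sum>k<N. \<bar>x k + y k\<bar> powr p) powr (1 / p) \<le> ((a + b) powr p) powr (1 / p)"
      using p by (intro powr_mono2 sum_nonneg) auto
    also have "\<dots> = a + b" using 3 p by (simp add: powr_powr)
    finally show ?thesis by (simp add: lp_norm_upto_def a_def b_def)
  qed
qed

section \<open>Hoelder's inequality and elementary power estimates\<close>

lemma Youngs_inequality_nonneg:
  fixes a b s t :: real
  assumes "0 \<le> s" "0 \<le> t" "s + t = 1" "a \<ge> 0" "b \<ge> 0"
  shows "a powr s * b powr t \<le> s * a + t * b"
  using assms Youngs_inequality_0[of s t a b] by (cases "a = 0 \<or> b = 0") auto

text \<open>After both sums are normalised to 1, Young's inequality is summed. The weight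
  \<open>t = 0\<close> has to be allowed, because \<open>t = 1 - 2 / p\<close> is used later and
  vanishes at \<open>p = 2\<close>.\<close>

lemma sum_powr_Holder:
  fixes a b :: "'i \<Rightarrow> real"
  assumes "\<And>k. k \<in> I \<Longrightarrow> a k \<ge> 0" "\<And>k. k \<in> I \<Longrightarrow> b k \<ge> 0"
    and "s \<ge> 0" "t \<ge> 0" "s + t = 1" "finite I"
  shows "(\<Sum>k\<in>I. a k powr s * b k powr t) \<le> (\<Sum>k\<in>I. a k) powr s * (\<Sum>k\<in>I. b k) powr t"
proof -
  define U where "U = (\<Sum>k\<in>I. a k)"
  define V where "V = (\<Sum>k\<in>I. b k)"
  have "U \<ge> 0" "V \<ge> 0" using assms by (auto simp: U_def V_def intro: sum_nonneg)
  then consider "U = 0" | "V = 0" | "U > 0" "V > 0" by linarith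
  then show ?thesis
  proof cases
    case 1
    then have "\<forall>k\<in>I. a k = 0" using assms by (simp add: U_def sum_nonneg_eq_0_iff)
    then show ?thesis using assms by simp
  next
    case 2
    then have "\<forall>k\<in>I. b k = 0" using assms by (simp add: V_def sum_nonneg_eq_0_iff)
    then show ?thesis using assms by simp
  next
    case 3
    have "(\<Sum>k\<in>I. a k powr s * b k powr t)
        = U powr s * V powr t * (\<Sum>k\<in>I. (a k / U) powr s * (b k / V) powr t)"
      using 3 assms by (auto simp: sum_distrib_left powr_divide intro!: sum.cong)
    also have "\<dots> \<le> U powr s * V powr t * (\<Sum>k\<in>I. s * (a k / U) + t * (b k / V))"
      using 3 assms by (intro mult_left_mono sum_mono Youngs_inequality_nonneg) auto
    also have "(\<Sum>k\<in>I. s * (a k / U) + t * (b k / V)) = s * (U / U) + t * (V / V)"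
      by (simp only: sum.distrib sum_distrib_left sum_divide_distrib U_def V_def)
    also have "\<dots> = 1" using 3 assms by simp
    finally show ?thesis by (simp add: U_def V_def)
  qed
qed

text \<open>Weighted arithmetic-geometric mean inequality for \<open>t powr r\<close> and 1 with
  weights \<open>1 / r\<close> and \<open>1 - 1 / r\<close>.\<close>

lemma powr_Bernoulli:
  fixes t r :: real
  assumes "t \<ge> 0" "r \<ge> 1"
  shows "1 - t powr r \<le> r * (1 - t)"
proof -
  have "(t powr r) powr (1 / r) * 1 powr (1 - 1 / r) \<le> 1 / r * t powr r + (1 - 1 / r) * 1"
    using assms by (intro Youngs_inequality_nonneg) auto
  then have "t \<le> 1 / r * t powr r + (1 - 1 / r)"
    using assms by (simp add: powr_powr)
  then have "r * t \<le> r * (1 / r * t powr r + (1 - 1 / r))"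
    using assms by (intro mult_left_mono) auto
  then show ?thesis using assms by (simp add: algebra_simps)
qed

text \<open>A mean value estimate without derivatives: factor out \<open>s powr r\<close> and apply
  Bernoulli at \<open>t / s\<close>.\<close>

lemma powr_diff_le:
  fixes s t r :: real
  assumes "0 \<le> t" "t \<le> s" "r \<ge> 1"
  shows "s powr r - t powr r \<le> r * (s - t) * s powr (r - 1)"
proof (cases "s = 0")
  case False
  with assms have s: "s > 0" by simp
  have "s powr r - t powr r = s powr r * (1 - (t / s) powr r)"
    using s assms by (simp add: powr_divide algebra_simps)
  also have "\<dots> \<le> s powr r * (r * (1 - t / s))"
    using s assms by (intro mult_left_mono powr_Bernoulli) auto
  also have "\<dots> = r * (s - t) * (s powr r / s)"
    using s by (simp add: field_simps)
  finally show ?thesis using s by (simp add: powr_diff)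
qed (use assms in auto)

text \<open>For equal signs this is the previous estimate. For opposite signs both differences turn
  into sums, and each power is at most its base times the power \<open>r - 1\<close> of the
  maximum.\<close>

lemma sgn_powr_diff_le:
  fixes s t r :: real
  assumes "r \<ge> 1"
  shows "\<bar>sgn s * \<bar>s\<bar> powr r - sgn t * \<bar>t\<bar> powr r\<bar>
    \<le> r * \<bar>s - t\<bar> * (max \<bar>s\<bar> \<bar>t\<bar>) powr (r - 1)"
proof -
  have same: "\<bar>s powr r - t powr r\<bar> \<le> r * \<bar>s - t\<bar> * (max s t) powr (r - 1)"
    if "0 \<le> s" "0 \<le> t" for s t
  proof (cases "t \<le> s")
    case True
    then show ?thesis using powr_diff_le[of t s r] powr_mono2[of r t s] that assms by (simp add: max_def)
  next
    case False
    then show ?thesis using powr_diff_le[of s t r] powr_mono2[of r s t] that assms by (simp add: max_def)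
  qed
  have bound: "x powr r \<le> x * (max x y) powr (r - 1)" if "0 \<le> x" for x y :: real
  proof -
    have "x powr r = x * x powr (r - 1)" using that by (simp add: powr_mult_base)
    also have "\<dots> \<le> x * (max x y) powr (r - 1)"
      using that assms by (intro mult_left_mono powr_mono2) auto
    finally show ?thesis .
  qed
  have opp: "s powr r + t powr r \<le> r * (s + t) * (max s t) powr (r - 1)" if "0 \<le> s" "0 \<le> t" for s t
  proof -
    have "s powr r + t powr r \<le> 1 * ((s + t) * (max s t) powr (r - 1))"
      using bound[of s t] bound[of t s] that by (simp add: algebra_simps max.commute)
    also have "\<dots> \<le> r * ((s + t) * (max s t) powr (r - 1))"
      using assms that by (intro mult_right_mono) auto
    finally show ?thesis by (simp add: mult.assoc)
  qed
  consider "s \<ge> 0" "t \<ge> 0" | "s < 0" "t < 0" | "s \<ge> 0" "t < 0" | "s < 0" "t \<ge> 0" by linarith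
  then show ?thesis
  proof cases
    case 1
    then show ?thesis using same[of s t] by (auto simp: sgn_if)
  next
    case 2
    then show ?thesis using same[of "-s" "-t"] by (auto simp: sgn_if abs_minus_commute)
  next
    case 3
    then show ?thesis using opp[of s "-t"] by (auto simp: sgn_if)
  next
    case 4
    then show ?thesis using opp[of "-s" t] powr_ge_zero[of "- s" r] powr_ge_zero[of t r]
      by (auto simp: sgn_if abs_if simp del: powr_ge_zero)
  qed
qed

section \<open>Norm preservation and the Lipschitz bound of the Mazur map\<close>

text \<open>The Mazur map between the spheres of \<open>l\<^sub>p\<close> and \<open>l\<^sub>2\<close>, extended to be homogeneous of degree one. At
  the origin it is 0 because \<open>0 powr a = 0\<close> also for \<open>a \<le> 0\<close>.\<close>

definition mazur_map :: "real \<Rightarrow> nat \<Rightarrow> (nat \<Rightarrow> real) \<Rightarrow> nat \<Rightarrow> real" where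
  "mazur_map p N x k = lp_norm_upto p N x powr (1 - p / 2) * (sgn (x k) * \<bar>x k\<bar> powr (p / 2))"

text \<open>Squaring gives the scalar factor the exponent \<open>2 - p\<close>, while the
  coordinates sum to the \<open>p\<close>-th power of the norm; the exponents add up to 2.\<close>

lemma sum_mazur_map_squared:
  assumes "p > 0"
  shows "(\<Sum>k<N. (mazur_map p N x k)\<^sup>2) = (lp_norm_upto p N x)\<^sup>2"
proof (cases "lp_norm_upto p N x = 0")
  case False
  define a where "a = lp_norm_upto p N x"
  have a: "a > 0" using False by (simp add: a_def less_le)
  have sq: "(z powr s)\<^sup>2 = z powr (2 * s)" for z s :: real
    by (simp add: power2_eq_square flip: powr_add)
  have "(mazur_map p N x k)\<^sup>2 = a powr (2 - p) * \<bar>x k\<bar> powr p" for k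
    by (cases "x k = 0") (simp_all add: mazur_map_def power_mult_distrib sq a_def sgn_if)
  then have "(\<Sum>k<N. (mazur_map p N x k)\<^sup>2) = a powr (2 - p) * (a powr p)"
    by (simp add: a_def lp_norm_upto_powr[OF assms] sum_distrib_left)
  also have "\<dots> = a\<^sup>2" using a by (simp flip: powr_add)
  finally show ?thesis by (simp add: a_def)
qed (simp add: mazur_map_def)

text \<open>By symmetry \<open>x\<close> may be taken as the vector of larger norm. With
  \<open>r = p / 2\<close>, two pieces of size at most \<open>3 / 2 * (r * d)\<close> and
  \<open>r * d\<close> add up to less than \<open>3 * (r * d)\<close> when
  \<open>d > 0\<close>.\<close>

lemma mazur_map_lipschitz:
  assumes p: "p \<ge> 2"
  shows "(\<Sum>k<N. (mazur_map p N x k - mazur_map p N y k)\<^sup>2)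
    \<le> (3 * p / 2 * lp_norm_upto p N (\<lambda>k. x k - y k))\<^sup>2"
proof -
  have main: "(\<Sum>k<N. (mazur_map p N x k - mazur_map p N y k)\<^sup>2)
      \<le> (3 * p / 2 * lp_norm_upto p N (\<lambda>k. x k - y k))\<^sup>2"
    if le: "lp_norm_upto p N y \<le> lp_norm_upto p N x" and pos: "lp_norm_upto p N x > 0" for x y
  proof -
    define r where "r = p / 2"
    define a where "a = lp_norm_upto p N x"
    define b where "b = lp_norm_upto p N y"
    define d where "d = lp_norm_upto p N (\<lambda>k. x k - y k)"
    define M where "M v k = sgn (v k) * \<bar>v k\<bar> powr r" for v :: "nat \<Rightarrow> real" and k
    define m where "m k = max \<bar>x k\<bar> \<bar>y k\<bar>" for k
    have r: "r \<ge> 1" and p_r: "p = 2 * r" using p by (auto simp: r_def)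
    have a: "a > 0" and b: "b \<ge> 0" and ba: "b \<le> a" and d: "d \<ge> 0"
      using le pos by (auto simp: a_def b_def d_def)
    have sq: "(z powr s)\<^sup>2 = z powr (2 * s)" for z s :: real
      by (simp add: power2_eq_square flip: powr_add)
    text \<open>The difference is split into \<open>a powr (1 - r) * (M x - M y)\<close>, controlled by Hoelder's
      inequality, and \<open>(a powr (1 - r) - b powr (1 - r)) * M y\<close>, controlled by \<open>a - b \<le> d\<close>.\<close>
    have "a \<le> d + b"
      using lp_norm_upto_triangle[of p N "\<lambda>k. x k - y k" y] p by (simp add: a_def b_def d_def)

    \<comment> \<open>The factors are rewritten as powers of \<open>p\<close>-th powers, so that
      Hoelder with weights \<open>2 / p\<close> and \<open>1 - 2 / p\<close> produces exactly
      \<open>d\<^sup>2\<close> and a power of the norms.\<close>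
    have "(\<Sum>k<N. (M x k - M y k)\<^sup>2) \<le> (\<Sum>k<N. r\<^sup>2 * ((\<bar>x k - y k\<bar> powr p) powr (2 / p) * (m k powr p) powr (1 - 2 / p)))"
    proof (intro sum_mono)
      fix k
      have "(M x k - M y k)\<^sup>2 = \<bar>M x k - M y k\<bar>\<^sup>2" by simp
      also have "\<dots> \<le> (r * \<bar>x k - y k\<bar> * m k powr (r - 1))\<^sup>2"
        unfolding M_def m_def using r by (intro power_mono sgn_powr_diff_le) auto
      also have "\<dots> = r\<^sup>2 * (\<bar>x k - y k\<bar>\<^sup>2 * m k powr (2 * r - 2))"
        by (simp only: power_mult_distrib sq right_diff_distrib mult.assoc mult_1_right)
      also have "\<bar>x k - y k\<bar>\<^sup>2 = (\<bar>x k - y k\<bar> powr p) powr (2 / p)"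
        using p by (simp add: powr_powr)
      also have "m k powr (2 * r - 2) = (m k powr p) powr (1 - 2 / p)"
        using p by (simp add: powr_powr p_r right_diff_distrib)
      finally show "(M x k - M y k)\<^sup>2 \<le> r\<^sup>2 * ((\<bar>x k - y k\<bar> powr p) powr (2 / p) * (m k powr p) powr (1 - 2 / p))" .
    qed
    also have "\<dots> = r\<^sup>2 * (\<Sum>k<N. (\<bar>x k - y k\<bar> powr p) powr (2 / p) * (m k powr p) powr (1 - 2 / p))"
      by (simp add: sum_distrib_left)
    also have "\<dots> \<le> r\<^sup>2 * ((\<Sum>k<N. \<bar>x k - y k\<bar> powr p) powr (2 / p) * (\<Sum>k<N. m k powr p) powr (1 - 2 / p))"
      using p by (intro mult_left_mono sum_powr_Holder) auto
    also have "(\<Sum>k<N. \<bar>x k - y k\<bar> powr p) powr (2 / p) = d\<^sup>2"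
      using p d lp_norm_upto_powr[of p N "\<lambda>k. x k - y k"] by (simp add: d_def powr_powr flip: lp_norm_upto_powr)
    also have "(\<Sum>k<N. m k powr p) powr (1 - 2 / p) \<le> (2 * a powr p) powr (1 - 2 / p)"
    proof (intro powr_mono2 sum_nonneg)
      have "(\<Sum>k<N. m k powr p) \<le> (\<Sum>k<N. \<bar>x k\<bar> powr p + \<bar>y k\<bar> powr p)"
        by (intro sum_mono) (auto simp: m_def max_def)
      also have "\<dots> = a powr p + b powr p"
        using p by (simp add: a_def b_def sum.distrib lp_norm_upto_powr)
      also have "\<dots> \<le> 2 * a powr p"
        using ba b p powr_mono2[of p b a] by simp
      finally show "(\<Sum>k<N. m k powr p) \<le> 2 * a powr p" .
    qed (use p in auto)
    also have "\<dots> \<le> 2 * a powr (p - 2)"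
    proof -
      have "(2 * a powr p) powr (1 - 2 / p) = 2 powr (1 - 2 / p) * a powr (p * (1 - 2 / p))"
        by (simp add: powr_mult powr_powr)
      also have "\<dots> \<le> 2 powr 1 * a powr (p * (1 - 2 / p))"
        using p by (intro mult_right_mono powr_mono) auto
      finally show ?thesis using p by (simp add: right_diff_distrib)
    qed
    finally have "(\<Sum>k<N. (M x k - M y k)\<^sup>2) \<le> r\<^sup>2 * (d\<^sup>2 * (2 * a powr (p - 2)))"
      by (simp add: mult_left_mono)
    then have "(a powr (1 - r))\<^sup>2 * (\<Sum>k<N. (M x k - M y k)\<^sup>2)
        \<le> (a powr (1 - r))\<^sup>2 * (r\<^sup>2 * (d\<^sup>2 * (2 * a powr (p - 2))))"
      by (rule mult_left_mono) auto
    also have "\<dots> = 2 * (r * d)\<^sup>2 * (a powr (2 - p) * a powr (p - 2))"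
      by (simp add: sq p_r right_diff_distrib power_mult_distrib)
    also have "\<dots> = 2 * (r * d)\<^sup>2" using a by (simp flip: powr_add)
    \<comment> \<open>The constant \<open>sqrt 2\<close> is rounded up to
      \<open>3 / 2\<close>.\<close>
    also have "\<dots> \<le> (3 / 2 * (r * d))\<^sup>2" 
      unfolding power_mult_distrib[of "3 / 2"] by (intro mult_right_mono) (simp_all add: power2_eq_square)
    finally have first: "L2_set (\<lambda>k. a powr (1 - r) * (M x k - M y k)) {..<N} \<le> 3 / 2 * (r * d)"
      unfolding L2_set_def power_mult_distrib sum_distrib_left[symmetric]
      using r d by (intro real_le_lsqrt) (auto simp: power_mult_distrib power_divide)

    have "(M y k)\<^sup>2 = \<bar>y k\<bar> powr p" for k
      by (cases "y k = 0") (simp_all add: M_def power_mult_distrib sq p_r sgn_if)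
    then have "L2_set (M y) {..<N} = b powr r"
      using b p by (simp add: L2_set_def b_def p_r powr_half_sqrt[symmetric] powr_powr flip: lp_norm_upto_powr)
    then have "L2_set (\<lambda>k. (a powr (1 - r) - b powr (1 - r)) * M y k) {..<N}
        = \<bar>a powr (1 - r) - b powr (1 - r)\<bar> * b powr r"
      by (simp add: L2_set_def power_mult_distrib sum_distrib_left[symmetric] real_sqrt_mult)
    also have "\<dots> \<le> r * d"
    proof (cases "b = 0")
      case True
      then show ?thesis using r d by simp
    next
      case False
      then have "b > 0" using b by simp
      \<comment> \<open>The exponent \<open>1 - r\<close> is nonpositive, so
        \<open>b \<le> a\<close> decides the sign. Bernoulli at \<open>b / a\<close> then yields
        \<open>r * (a - b)\<close>.\<close>
      then have "\<bar>a powr (1 - r) - b powr (1 - r)\<bar> * b powr r = (b powr (1 - r) - a powr (1 - r)) * b powr r"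
        using ba r powr_mono2'[of "1 - r" b a] by simp
      also have "\<dots> = b - a * (b / a) powr r"
        using \<open>b > 0\<close> a by (simp add: left_diff_distrib powr_divide powr_diff field_simps)
      also have "\<dots> \<le> a * (1 - (b / a) powr r)" using ba by (simp add: right_diff_distrib)
      also have "\<dots> \<le> a * (r * (1 - b / a))"
        using \<open>b > 0\<close> a r by (intro mult_left_mono powr_Bernoulli) auto
      also have "\<dots> = r * (a - b)" using a by (simp add: field_simps)
      also have "\<dots> \<le> r * d" using \<open>a \<le> d + b\<close> r by (intro mult_left_mono) auto
      finally show ?thesis .
    qed
    finally have second: "L2_set (\<lambda>k. (a powr (1 - r) - b powr (1 - r)) * M y k) {..<N} \<le> r * d" .

    have "mazur_map p N x k - mazur_map p N y k
        = a powr (1 - r) * (M x k - M y k) + (a powr (1 - r) - b powr (1 - r)) * M y k" for k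
      by (simp add: mazur_map_def a_def b_def M_def r_def algebra_simps)
    then have "L2_set (\<lambda>k. mazur_map p N x k - mazur_map p N y k) {..<N}
        \<le> L2_set (\<lambda>k. a powr (1 - r) * (M x k - M y k)) {..<N}
          + L2_set (\<lambda>k. (a powr (1 - r) - b powr (1 - r)) * M y k) {..<N}"
      by (simp only: L2_set_triangle_ineq)
    also have "\<dots> \<le> 3 / 2 * (r * d) + r * d" using first second by (rule add_mono)
    also have "\<dots> \<le> 3 * (r * d)" using r d by simp
    finally have "(L2_set (\<lambda>k. mazur_map p N x k - mazur_map p N y k) {..<N})\<^sup>2 \<le> (3 * (r * d))\<^sup>2"
      by (intro power_mono) auto
    then show ?thesis
      by (simp add: L2_set_def sum_nonneg d_def r_def mult.assoc)
  qed
  consider "lp_norm_upto p N x = 0" "lp_norm_upto p N y = 0"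
    | "lp_norm_upto p N y \<le> lp_norm_upto p N x" "lp_norm_upto p N x > 0"
    | "lp_norm_upto p N x \<le> lp_norm_upto p N y" "lp_norm_upto p N y > 0"
    using lp_norm_upto_nonneg[of p N x] lp_norm_upto_nonneg[of p N y] by linarith
  then show ?thesis
  proof cases
    case 1
    then show ?thesis by (simp add: mazur_map_def)
  next
    case 2
    then show ?thesis by (rule main)
  next
    case 3
    then show ?thesis
      using main[of x y] by (simp add: power2_commute lp_norm_upto_minus_commute[of p N x y])
  qed
qed

section \<open>The second eigenvalue of a symmetric stochastic matrix\<close>

text \<open>Index 1 of the descending list is index \<open>L - 2\<close> of the ascending one. If
  that entry were below \<open>b\<close>, only the last entry could reach \<open>b\<close>, whereas
  \<open>a\<close> and \<open>b\<close> account for two, even if they are equal.\<close>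

lemma nth_1_rev_sorted_list_of_multiset_ge:
  fixes a b :: "'a::linorder"
  assumes "{#a, b#} \<subseteq># M" "b \<le> a"
  shows "b \<le> rev (sorted_list_of_multiset M) ! 1"
proof (rule ccontr)
  define ys where "ys = sorted_list_of_multiset M"
  define L where "L = length ys"
  assume "\<not> ?thesis"
  then have *: "rev ys ! 1 < b" by (simp add: ys_def)
  have "size {#a, b#} \<le> size M" using assms(1) by (rule size_mset_mono)
  then have L2: "2 \<le> L" unfolding L_def ys_def by (metis mset_sorted_list_of_multiset numeral_2_eq_2 size_add_mset size_empty size_mset)
  then have less: "ys ! (L - 2) < b" using * by (simp add: rev_nth L_def numeral_2_eq_2)
  have sorted: "sorted ys" by (simp add: ys_def)
  have "i = L - 1" if "i < L" "b \<le> ys ! i" for i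
  proof (rule ccontr)
    assume "i \<noteq> L - 1"
    then have "ys ! i \<le> ys ! (L - 2)"
      using that L2 sorted by (intro sorted_nth_mono) (auto simp: L_def)
    with less that show False by auto
  qed
  then have "{i. i < length ys \<and> b \<le> ys ! i} \<subseteq> {L - 1}" by (auto simp: L_def)
  then have "card {i. i < length ys \<and> b \<le> ys ! i} \<le> card {L - 1}"
    by (intro card_mono) auto
  then have "length (filter (\<lambda>x. b \<le> x) ys) \<le> 1"
    by (simp add: length_filter_conv_card)
  moreover have "size (filter_mset (\<lambda>x. b \<le> x) {#a, b#}) \<le> size (filter_mset (\<lambda>x. b \<le> x) M)"
    using assms(1) by (intro size_mset_mono multiset_filter_mono)
  moreover have "size (filter_mset (\<lambda>x. b \<le> x) M) = length (filter (\<lambda>x. b \<le> x) ys)"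
    by (metis mset_filter mset_sorted_list_of_multiset size_mset ys_def)
  ultimately show False using assms(2) by simp
qed

text \<open>Conjugation by the identity matrix with its first column replaced by ones, which is an
  eigenvector for the eigenvalue 1.\<close>

lemma char_poly_row_sums_1:
  fixes A :: "'a::field mat"
  assumes A: "A \<in> carrier_mat (Suc m) (Suc m)"
    and rows: "\<And>i. i < Suc m \<Longrightarrow> (\<Sum>j<Suc m. A $$ (i, j)) = 1"
  shows "char_poly A =
    [:- 1, 1:] * char_poly (mat m m (\<lambda>(i, j). A $$ (Suc i, Suc j) - A $$ (0, Suc j)))"
proof -
  define D where "D = mat m m (\<lambda>(i, j). A $$ (Suc i, Suc j) - A $$ (0, Suc j))"
  define R where "R = mat 1 m (\<lambda>(i, j). A $$ (0, Suc j))"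
  \<comment> \<open>\<open>B\<close> represents \<open>A\<close> in the new basis; its block
    \<open>D\<close> is the action on the quotient by the constant vectors.\<close>
  define B where "B = four_block_mat (1\<^sub>m 1) R (0\<^sub>m m 1) D"
  define P :: "'a mat" where
    "P = mat (Suc m) (Suc m) (\<lambda>(i, j). if j = 0 then 1 else if i = j then 1 else 0)"
  define Q :: "'a mat" where
    "Q = mat (Suc m) (Suc m) (\<lambda>(i, j). (if i = j then 1 else 0) - (if j = 0 \<and> i \<noteq> 0 then 1 else 0))"
  have D: "D \<in> carrier_mat m m" and R: "R \<in> carrier_mat 1 m"
    and B: "B \<in> carrier_mat (Suc m) (Suc m)" and P: "P \<in> carrier_mat (Suc m) (Suc m)"
    and Q: "Q \<in> carrier_mat (Suc m) (Suc m)"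
    by (auto simp: D_def R_def B_def P_def Q_def)
  have B_nth: "B $$ (i, j) = (if j = 0 then if i = 0 then 1 else 0 else
      if i = 0 then A $$ (0, j) else A $$ (i, j) - A $$ (0, j))" if "i < Suc m" "j < Suc m" for i j
    using that by (auto simp: B_def D_def R_def)
  have mult: "(X * Y) $$ (i, j) = (\<Sum>k<Suc m. X $$ (i, k) * Y $$ (k, j))"
    if "X \<in> carrier_mat (Suc m) (Suc m)" "Y \<in> carrier_mat (Suc m) (Suc m)" "i < Suc m" "j < Suc m"
    for X Y :: "'a mat" and i j
    using that by (auto simp: scalar_prod_def lessThan_atLeast0 intro!: sum.cong)
  have PQ: "P * Q = 1\<^sub>m (Suc m)"
  proof (rule eq_matI)
    fix i j assume "i < dim_row (1\<^sub>m (Suc m) :: 'a mat)" "j < dim_col (1\<^sub>m (Suc m) :: 'a mat)"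
    then have ij: "i < Suc m" "j < Suc m" by auto
    have "(P * Q) $$ (i, j) = P $$ (i, 0) * Q $$ (0, j) + (\<Sum>k<m. P $$ (i, Suc k) * Q $$ (Suc k, j))"
      unfolding mult[OF P Q ij] sum.lessThan_Suc_shift by (rule refl)
    also have "(\<Sum>k<m. P $$ (i, Suc k) * Q $$ (Suc k, j)) = (\<Sum>k<m. if Suc k = i then Q $$ (i, j) else 0)"
      using ij by (intro sum.cong) (auto simp: P_def)
    also have "\<dots> = (if i = 0 then 0 else Q $$ (i, j))"
      using ij by (cases i) (auto simp: sum.delta)
    also have "P $$ (i, 0) * Q $$ (0, j) + \<dots> = 1\<^sub>m (Suc m) $$ (i, j)"
      using ij by (auto simp: P_def Q_def)
    finally show "(P * Q) $$ (i, j) = 1\<^sub>m (Suc m) $$ (i, j)" .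
  qed (auto simp: P_def Q_def)
  have QP: "Q * P = 1\<^sub>m (Suc m)"
    using mat_mult_left_right_inverse[OF P Q PQ] .
  \<comment> \<open>The row sums enter only through the first column of \<open>A * P\<close>; its
    other columns are those of \<open>A\<close>.\<close>
  have AP: "A * P = P * B"
  proof (rule eq_matI)
    fix i j assume "i < dim_row (P * B)" "j < dim_col (P * B)"
    then have ij: "i < Suc m" "j < Suc m" using P B by auto
    have "(A * P) $$ (i, j) = (if j = 0 then 1 else A $$ (i, j))"
    proof (cases "j = 0")
      case True
      have "(A * P) $$ (i, j) = (\<Sum>k<Suc m. A $$ (i, k))"
        unfolding mult[OF A P ij] using True by (intro sum.cong) (auto simp: P_def)
      then show ?thesis using True rows[OF ij(1)] by simp
    next
      case False
      have "(A * P) $$ (i, j) = (\<Sum>k<Suc m. if k = j then A $$ (i, j) else 0)"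
        unfolding mult[OF A P ij] using False ij by (intro sum.cong) (auto simp: P_def)
      then show ?thesis using False ij by (simp add: sum.delta)
    qed
    moreover have "(P * B) $$ (i, j) = P $$ (i, 0) * B $$ (0, j) + (\<Sum>k<m. P $$ (i, Suc k) * B $$ (Suc k, j))"
      unfolding mult[OF P B ij] sum.lessThan_Suc_shift by (rule refl)
    moreover have "(\<Sum>k<m. P $$ (i, Suc k) * B $$ (Suc k, j)) = (\<Sum>k<m. if Suc k = i then B $$ (i, j) else 0)"
      using ij by (intro sum.cong) (auto simp: P_def)
    moreover have "\<dots> = (if i = 0 then 0 else B $$ (i, j))"
      using ij by (cases i) (auto simp: sum.delta)
    ultimately show "(A * P) $$ (i, j) = (P * B) $$ (i, j)"
      using ij by (auto simp: B_nth P_def)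
  qed (use A P B in auto)
  have "A = A * (P * Q)" using A PQ by simp
  also have "\<dots> = P * B * Q" using A P Q by (simp flip: AP)
  finally have "similar_mat A B"
    using A B P Q PQ QP
    unfolding similar_mat_def by (intro exI[of _ P] exI[of _ Q] similar_mat_witI[of P Q "Suc m"]) auto
  then have "char_poly A = char_poly B" by (rule char_poly_similar)
  also have "\<dots> = char_poly (1\<^sub>m 1) * char_poly D"
    unfolding B_def using R D by (intro char_poly_four_block_zeros_col) auto
  also have "char_poly (1\<^sub>m 1 :: 'a mat) = [:- 1, 1:]"
    by (simp add: char_poly_defs det_single)
  finally show ?thesis by (simp add: D_def)
qed

section \<open>The variational principle on vectors of sum zero\<close>

text \<open>The Rayleigh quotient attains its maximum on the unit sphere of the sum-zero space.
  Since \<open>a\<close> preserves this space, the residual at the maximiser is an admissible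
  direction of variation.\<close>

lemma symmetric_form_max_orthogonal_ones:
  fixes a :: "nat \<Rightarrow> nat \<Rightarrow> real"
  assumes n: "n \<ge> 2"
    and sym: "\<And>i j. i < n \<Longrightarrow> j < n \<Longrightarrow> a i j = a j i"
    and rows: "\<And>i. i < n \<Longrightarrow> (\<Sum>j<n. a i j) = 1"
  obtains \<mu> v where "(\<Sum>i<n. v i) = 0" "(\<Sum>i<n. (v i)\<^sup>2) = 1"
    "\<And>i. i < n \<Longrightarrow> (\<Sum>j<n. a i j * v j) = \<mu> * v i"
    "\<And>w. (\<Sum>i<n. w i) = 0 \<Longrightarrow> (\<Sum>i<n. \<Sum>j<n. a i j * w i * w j) \<le> \<mu> * (\<Sum>i<n. (w i)\<^sup>2)"
proof -
  define Q where "Q w = (\<Sum>i<n. \<Sum>j<n. a i j * w i * w j)" for w :: "nat \<Rightarrow> real"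
  \<comment> \<open>The sphere is cut out of a compact product; coordinates beyond \<open>n\<close>
    are pinned to 0.\<close>
  define K where "K = PiE UNIV (\<lambda>i. if i < n then {-1..1} else {0::real})
      \<inter> {w. (\<Sum>i<n. w i) = 0} \<inter> {w. (\<Sum>i<n. (w i)\<^sup>2) = 1}"
  have "compact K"
    unfolding K_def by (intro compact_Int_closed compact_PiE_UNIV closed_Collect_eq continuous_intros) auto
  moreover have "K \<noteq> {}"
  proof -
    \<comment> \<open>The unit vector proportional to \<open>(1, -1, 0, ...)\<close> shows that
      \<open>K\<close> is nonempty; this needs two coordinates.\<close>
    define c :: real where "c = 1 / sqrt 2"
    define e where "e i = (if i = 0 then c else if i = 1 then - c else 0)" for i :: nat
    have c: "0 \<le> c" "c \<le> 1" "c\<^sup>2 = 1 / 2" by (simp_all add: c_def power_divide)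
    have n01: "{..<n} = insert 0 (insert 1 {2..<n})" using n by auto
    have "(\<Sum>i<n. e i) = 0" "(\<Sum>i<n. (e i)\<^sup>2) = 1" unfolding n01 by (simp_all add: e_def c)
    moreover have "e i \<in> (if i < n then {- 1..1} else {0})" for i using n c by (simp add: e_def)
    ultimately have "e \<in> K" by (simp add: K_def PiE_iff)
    then show ?thesis by blast
  qed
  moreover have "continuous_on K Q"
    unfolding Q_def by (intro continuous_intros continuous_on_subset[OF continuous_on_product_coordinates]) auto
  ultimately obtain v where vK: "v \<in> K" and vmax: "\<And>w. w \<in> K \<Longrightarrow> Q w \<le> Q v"
    using continuous_attains_sup[of K Q] by blast
  define \<mu> where "\<mu> = Q v"
  have v0: "(\<Sum>i<n. v i) = 0" and v1: "(\<Sum>i<n. (v i)\<^sup>2) = 1" using vK by (auto simp: K_def)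
  have bound: "Q w \<le> \<mu> * (\<Sum>i<n. (w i)\<^sup>2)" if w: "(\<Sum>i<n. w i) = 0" for w
  proof (cases "(\<Sum>i<n. (w i)\<^sup>2) = 0")
    case True
    then have "\<forall>i<n. w i = 0" by (simp add: sum_nonneg_eq_0_iff)
    then show ?thesis by (simp add: Q_def)
  next
    case False
    define s where "s = (\<Sum>i<n. (w i)\<^sup>2)"
    have s: "s > 0" using False by (simp add: s_def sum_nonneg less_le)
    define u where "u i = (if i < n then w i / sqrt s else 0)" for i
    have "(\<Sum>i<n. u i) = (\<Sum>i<n. w i) / sqrt s" by (simp add: u_def sum_divide_distrib)
    moreover have u1: "(\<Sum>i<n. (u i)\<^sup>2) = 1"
      using s by (simp add: u_def power_divide s_def flip: sum_divide_distrib)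
    moreover have u_le: "\<bar>u i\<bar> \<le> 1" if "i < n" for i
    proof -
      have "(u i)\<^sup>2 \<le> (\<Sum>i<n. (u i)\<^sup>2)" using that by (intro member_le_sum) auto
      then show ?thesis using u1 by (simp add: abs_square_le_1)
    qed
    moreover have "u i \<in> (if i < n then {- 1..1} else {0})" for i
    proof (cases "i < n")
      case True
      then show ?thesis using u_le[of i] by (simp add: abs_le_iff minus_le_iff)
    qed (simp add: u_def)
    ultimately have "u \<in> K" using w by (simp add: K_def PiE_iff)
    then have "Q u \<le> \<mu>" using vmax by (simp add: \<mu>_def)
    moreover have "Q u = Q w / s"
      using s by (simp add: Q_def u_def sum_divide_distrib)
    ultimately show ?thesis using s by (simp add: s_def pos_divide_le_eq)
  qed
  \<comment> \<open>The residual has sum zero, because by symmetry the column sums are 1 as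
    well.\<close>
  define g where "g i = (\<Sum>j<n. a i j * v j) - \<mu> * v i" for i
  have "(\<Sum>i<n. \<Sum>j<n. a i j * v j) = (\<Sum>j<n. \<Sum>i<n. a j i * v j)"
    by (subst sum.swap) (auto simp: sym intro!: sum.cong)
  also have "\<dots> = 0" using rows v0 by (simp flip: sum_distrib_right)
  finally have g0: "(\<Sum>i<n. g i) = 0" using v0 by (simp add: g_def sum_subtractf flip: sum_distrib_left)
  define G where "G = (\<Sum>i<n. (g i)\<^sup>2)"
  define c where "c = \<mu> * G - Q g"
  text \<open>Moving from the maximiser \<open>v\<close> in the direction of the residual \<open>g\<close> would increase
    the quotient at first order unless \<open>g = 0\<close>.\<close>
  have ineq: "2 * t * G \<le> t\<^sup>2 * c" for t
  proof -
    have z: "(\<Sum>i<n. v i + t * g i) = 0" using v0 g0 by (simp add: sum.distrib flip: sum_distrib_left)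
    have Qexp: "Q (\<lambda>i. v i + t * g i) = Q v + 2 * t * (\<Sum>i<n. g i * (\<Sum>j<n. a i j * v j)) + t\<^sup>2 * Q g"
    proof -
      have "(\<Sum>i<n. \<Sum>j<n. a i j * v i * g j) = (\<Sum>i<n. \<Sum>j<n. a i j * v j * g i)"
        by (subst sum.swap) (auto simp: sym intro!: sum.cong)
      then have "(\<Sum>i<n. \<Sum>j<n. a i j * v i * g j) = (\<Sum>i<n. g i * (\<Sum>j<n. a i j * v j))"
        by (simp add: sum_distrib_left mult_ac)
      moreover have "(\<Sum>i<n. \<Sum>j<n. a i j * g i * v j) = (\<Sum>i<n. g i * (\<Sum>j<n. a i j * v j))"
        by (simp add: sum_distrib_left mult_ac)
      moreover have "Q (\<lambda>i. v i + t * g i) = Q v + t * (\<Sum>i<n. \<Sum>j<n. a i j * v i * g j)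
          + t * (\<Sum>i<n. \<Sum>j<n. a i j * g i * v j) + t\<^sup>2 * Q g"
      proof -
        have "a i j * (v i + t * g i) * (v j + t * g j) = a i j * v i * v j + t * (a i j * v i * g j)
            + t * (a i j * g i * v j) + t\<^sup>2 * (a i j * g i * g j)" for i j
          by (simp add: algebra_simps power2_eq_square)
        then show ?thesis by (simp only: Q_def sum.distrib sum_distrib_left)
      qed
      ultimately show ?thesis by simp
    qed
    have Sexp: "(\<Sum>i<n. (v i + t * g i)\<^sup>2) = 1 + 2 * t * (\<Sum>i<n. g i * v i) + t\<^sup>2 * G"
    proof -
      have "(\<Sum>i<n. (v i + t * g i)\<^sup>2) = (\<Sum>i<n. (v i)\<^sup>2) + 2 * t * (\<Sum>i<n. g i * v i) + t\<^sup>2 * G"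
      proof -
        have "(v i + t * g i)\<^sup>2 = (v i)\<^sup>2 + 2 * t * (g i * v i) + t\<^sup>2 * (g i)\<^sup>2" for i
          by (simp add: algebra_simps power2_eq_square)
        then show ?thesis by (simp only: G_def sum.distrib sum_distrib_left)
      qed
      then show ?thesis by (simp add: v1)
    qed
    have "G = (\<Sum>i<n. g i * (\<Sum>j<n. a i j * v j)) - \<mu> * (\<Sum>i<n. g i * v i)"
    proof -
      have "G = (\<Sum>i<n. g i * ((\<Sum>j<n. a i j * v j) - \<mu> * v i))"
        by (simp add: G_def g_def power2_eq_square)
      also have "\<dots> = (\<Sum>i<n. g i * (\<Sum>j<n. a i j * v j) - \<mu> * (g i * v i))"
        by (simp add: right_diff_distrib mult_ac)
      also have "\<dots> = (\<Sum>i<n. g i * (\<Sum>j<n. a i j * v j)) - \<mu> * (\<Sum>i<n. g i * v i)"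
        by (simp only: sum_subtractf sum_distrib_left)
      finally show ?thesis .
    qed
    moreover define X where "X = (\<Sum>i<n. g i * (\<Sum>j<n. a i j * v j))"
    moreover define Y where "Y = (\<Sum>i<n. g i * v i)"
    ultimately have G_eq: "G = X - \<mu> * Y" by simp
    have "\<mu> + 2 * t * X + t\<^sup>2 * Q g \<le> \<mu> * (1 + 2 * t * Y + t\<^sup>2 * G)"
      using bound[OF z] unfolding Qexp Sexp \<mu>_def[symmetric] X_def Y_def .
    then have "2 * t * (X - \<mu> * Y) \<le> t\<^sup>2 * (\<mu> * G - Q g)" by (simp add: algebra_simps)
    then show ?thesis by (simp only: c_def flip: G_eq)
  qed
  have "G = 0"
  proof (rule ccontr)
    assume "G \<noteq> 0"
    then have G: "G > 0" by (simp add: G_def sum_nonneg less_le)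
    \<comment> \<open>At \<open>t = G / c\<close>, the maximiser of
      \<open>2 * t * G - t\<^sup>2 * c\<close>, the inequality would give
      \<open>2 * G\<^sup>2 / c \<le> G\<^sup>2 / c\<close>.\<close>
    have "c > 0" using ineq[of 1] G by simp
    then show False using ineq[of "G / c"] G by (simp add: power2_eq_square field_simps)
  qed
  then have "\<forall>i<n. g i = 0" by (simp add: G_def sum_nonneg_eq_0_iff)
  then show ?thesis
    using that[of v \<mu>] v0 v1 bound by (simp add: g_def Q_def)
qed

section \<open>The Dirichlet form and the second eigenvalue\<close>

text \<open>Expand the square: row sums, and by symmetry column sums, turn both diagonal terms into
  the squared norm.\<close>

lemma stochastic_dirichlet_form:
  fixes a :: "nat \<Rightarrow> nat \<Rightarrow> real"
  assumes sym: "\<And>i j. i < n \<Longrightarrow> j < n \<Longrightarrow> a i j = a j i"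
    and rows: "\<And>i. i < n \<Longrightarrow> (\<Sum>j<n. a i j) = 1"
  shows "(\<Sum>i<n. \<Sum>j<n. a i j * (v i - v j)\<^sup>2)
    = 2 * (\<Sum>i<n. (v i)\<^sup>2) - 2 * (\<Sum>i<n. \<Sum>j<n. a i j * v i * v j)"
proof -
  have left: "(\<Sum>i<n. \<Sum>j<n. a i j * (v i)\<^sup>2) = (\<Sum>i<n. (v i)\<^sup>2)"
    using rows by (simp flip: sum_distrib_right)
  have "(\<Sum>i<n. \<Sum>j<n. a i j * (v j)\<^sup>2) = (\<Sum>j<n. \<Sum>i<n. a j i * (v j)\<^sup>2)"
    by (subst sum.swap) (auto simp: sym intro!: sum.cong)
  also have "\<dots> = (\<Sum>i<n. (v i)\<^sup>2)" by (rule left)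
  finally have right: "(\<Sum>i<n. \<Sum>j<n. a i j * (v j)\<^sup>2) = (\<Sum>i<n. (v i)\<^sup>2)" .
  have "(\<Sum>i<n. \<Sum>j<n. a i j * (v i - v j)\<^sup>2)
      = (\<Sum>i<n. \<Sum>j<n. a i j * (v i)\<^sup>2) + (\<Sum>i<n. \<Sum>j<n. a i j * (v j)\<^sup>2)
        - 2 * (\<Sum>i<n. \<Sum>j<n. a i j * v i * v j)"
  proof -
    have "a i j * (v i - v j)\<^sup>2 = a i j * (v i)\<^sup>2 + a i j * (v j)\<^sup>2 - 2 * (a i j * v i * v j)" for i j
      by (simp add: algebra_simps power2_eq_square)
    then show ?thesis by (simp only: sum.distrib sum_subtractf sum_distrib_left)
  qed
  then show ?thesis by (simp add: left right)
qed

lemma symmetric_stochasticD: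
  assumes "symmetric_stochastic A" "A \<in> carrier_mat n n"
  shows "\<And>i j. i < n \<Longrightarrow> j < n \<Longrightarrow> A $$ (i, j) = A $$ (j, i)"
    and "\<And>i. i < n \<Longrightarrow> (\<Sum>j<n. A $$ (i, j)) = 1"
    and "\<And>i j. i < n \<Longrightarrow> j < n \<Longrightarrow> A $$ (i, j) \<ge> 0"
proof -
  fix i j assume "i < n" "j < n"
  then show "A $$ (i, j) = A $$ (j, i)"
    using assms index_transpose_mat(1)[of j A i] by (auto simp: symmetric_stochastic_def)
qed (use assms in \<open>auto simp: symmetric_stochastic_def\<close>)

text \<open>The Dirichlet form of an eigenvector is nonnegative and equals
  \<open>2 * (1 - e)\<close> times its squared norm.\<close>

lemma symmetric_stochastic_eigenvalue_le_1:
  assumes ss: "symmetric_stochastic A" and A: "A \<in> carrier_mat n n" and ev: "eigenvalue A e"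
  shows "e \<le> 1"
proof -
  note D = symmetric_stochasticD[OF ss A]
  obtain w where w: "w \<in> carrier_vec n" "w \<noteq> 0\<^sub>v n" and Aw: "A *\<^sub>v w = e \<cdot>\<^sub>v w"
    using ev A by (auto simp: eigenvalue_def eigenvector_def)
  have row: "(\<Sum>j<n. A $$ (i, j) * w $ j) = e * w $ i" if "i < n" for i
  proof -
    have "(\<Sum>j<n. A $$ (i, j) * w $ j) = (A *\<^sub>v w) $ i"
      using that A w by (simp add: scalar_prod_def lessThan_atLeast0)
    then show ?thesis using that w by (simp add: Aw)
  qed
  have "(\<Sum>i<n. \<Sum>j<n. A $$ (i, j) * w $ i * w $ j) = (\<Sum>i<n. w $ i * (\<Sum>j<n. A $$ (i, j) * w $ j))"
    by (simp add: sum_distrib_left mult_ac)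
  also have "\<dots> = (\<Sum>i<n. w $ i * (e * w $ i))" by (simp add: row)
  also have "\<dots> = e * (\<Sum>i<n. (w $ i)\<^sup>2)"
    by (simp add: sum_distrib_left power2_eq_square mult_ac)
  moreover have "0 \<le> (\<Sum>i<n. \<Sum>j<n. A $$ (i, j) * (w $ i - w $ j)\<^sup>2)"
    using D by (intro sum_nonneg mult_nonneg_nonneg) auto
  ultimately have "e * (\<Sum>i<n. (w $ i)\<^sup>2) \<le> 1 * (\<Sum>i<n. (w $ i)\<^sup>2)"
    using stochastic_dirichlet_form[of n "\<lambda>i j. A $$ (i, j)" "\<lambda>i. w $ i"] D by simp
  moreover have "(\<Sum>i<n. (w $ i)\<^sup>2) > 0"
  proof -
    obtain i where "i < n" "w $ i \<noteq> 0" using w by (metis carrier_vecD eq_vecI index_zero_vec)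
    then show ?thesis by (intro sum_pos2[of _ i]) auto
  qed
  ultimately show ?thesis by (simp only: mult_le_cancel_right_pos)
qed

text \<open>The constrained maximum \<open>\<mu>\<close> is an eigenvalue on the quotient by
  constants, so it accompanies the eigenvalue 1 of the constants in the spectrum and lies below the
  second entry.\<close>

lemma symmetric_stochastic_second_eigenvalue:
  assumes n: "n \<ge> 2" and A: "A \<in> carrier_mat n n" and ss: "symmetric_stochastic A"
  shows "nth_eigenvalue 2 A \<le> 1"
    and "(\<Sum>i<n. w i) = 0 \<Longrightarrow>
      (\<Sum>i<n. \<Sum>j<n. A $$ (i, j) * w i * w j) \<le> nth_eigenvalue 2 A * (\<Sum>i<n. (w i)\<^sup>2)"
proof -
  note D = symmetric_stochasticD[OF ss A]
  obtain \<mu> v where v0: "(\<Sum>i<n. v i) = 0" and v1: "(\<Sum>i<n. (v i)\<^sup>2) = 1"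
    and Av: "\<And>i. i < n \<Longrightarrow> (\<Sum>j<n. A $$ (i, j) * v j) = \<mu> * v i"
    and bound: "\<And>w. (\<Sum>i<n. w i) = 0 \<Longrightarrow>
      (\<Sum>i<n. \<Sum>j<n. A $$ (i, j) * w i * w j) \<le> \<mu> * (\<Sum>i<n. (w i)\<^sup>2)"
    by (rule symmetric_form_max_orthogonal_ones[of n "\<lambda>i j. A $$ (i, j)"])
      (use n D in \<open>assumption | blast\<close>)+
  obtain m where n_Suc: "n = Suc m" using n by (cases n) auto
  define B where "B = Matrix.mat m m (\<lambda>(i, j). A $$ (Suc i, Suc j) - A $$ (0, Suc j))"
  \<comment> \<open>The image of \<open>v\<close> in the quotient by constants. It is nonzero,
    because a constant \<open>v\<close> of sum zero would vanish.\<close>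
  define u where "u = Matrix.vec m (\<lambda>i. v (Suc i) - v 0)"
  have cp: "char_poly A = [:- 1, 1:] * char_poly B"
    unfolding B_def using A D n_Suc by (intro char_poly_row_sums_1) auto
  have Bc: "B \<in> carrier_mat m m" by (simp add: B_def)
  have "eigenvector B u \<mu>"
    unfolding eigenvector_def
  proof (intro conjI)
    show "u \<noteq> 0\<^sub>v (dim_row B)"
    proof
      assume u: "u = 0\<^sub>v (dim_row B)"
      have const: "v i = v 0" if "i < n" for i
      proof (cases i)
        case (Suc k)
        then have "u $ k = 0" using that u n_Suc Bc by simp
        then show ?thesis using that Suc n_Suc by (simp add: u_def)
      qed simp
      have "(\<Sum>i<n. v i) = (\<Sum>i<n. v 0)" by (intro sum.cong refl const) simp
      with v0 n have "v 0 = 0" by simp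
      with const have "v i = 0" if "i < n" for i using that by metis
      then have "(\<Sum>i<n. (v i)\<^sup>2) = 0" by simp
      with v1 show False by simp
    qed
    show "B *\<^sub>v u = \<mu> \<cdot>\<^sub>v u"
    proof (rule eq_vecI)
      fix i assume "i < dim_vec (\<mu> \<cdot>\<^sub>v u)"
      then have i: "i < m" by (simp add: u_def)
      have "(B *\<^sub>v u) $ i = (\<Sum>j<m. (A $$ (Suc i, Suc j) - A $$ (0, Suc j)) * (v (Suc j) - v 0))"
        using i by (simp add: B_def u_def scalar_prod_def lessThan_atLeast0)
      \<comment> \<open>The added term \<open>j = 0\<close> vanishes because of the factor
        \<open>v 0 - v 0\<close>.\<close>
      also have "\<dots> = (\<Sum>j<n. (A $$ (Suc i, j) - A $$ (0, j)) * (v j - v 0))"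
        unfolding n_Suc sum.lessThan_Suc_shift by simp
      also have "\<dots> = ((\<Sum>j<n. A $$ (Suc i, j) * v j) - (\<Sum>j<n. A $$ (0, j) * v j))
          - ((\<Sum>j<n. A $$ (Suc i, j)) - (\<Sum>j<n. A $$ (0, j))) * v 0"
        by (simp add: left_diff_distrib right_diff_distrib sum_subtractf sum_distrib_right)
      also have "\<dots> = \<mu> * (v (Suc i) - v 0)"
        using i n_Suc Av D(2) by (simp add: right_diff_distrib)
      finally show "(B *\<^sub>v u) $ i = (\<mu> \<cdot>\<^sub>v u) $ i" using i by (simp add: u_def)
    qed (simp add: B_def u_def)
  qed (simp add: B_def u_def)
  then have root: "poly (char_poly B) \<mu> = 0"
    using eigenvalue_root_char_poly[OF Bc] by (auto simp: eigenvalue_def)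
  have B0: "char_poly B \<noteq> 0" using degree_monic_char_poly[OF Bc] by auto
  have A0: "char_poly A \<noteq> 0" using degree_monic_char_poly[OF A] by auto
  have "proots (char_poly A) = proots [:- 1, 1:] + proots (char_poly B)"
    unfolding cp using B0 by (intro proots_mult) auto
  moreover have "1 \<in># proots [:- 1, 1 :: real:]" "\<mu> \<in># proots (char_poly B)"
    using root B0 by simp_all
  \<comment> \<open>Adding the root multisets of the two factors counts 1 twice if
    \<open>\<mu> = 1\<close>.\<close>
  ultimately have sub: "{#1, \<mu>#} \<subseteq># proots (char_poly A)"
    using subset_mset.add_mono[of "{#1#}" "proots [:- 1, 1:]" "{#\<mu>#}" "proots (char_poly B)"]
    by (simp add: add_mset_commute)
  have root_le: "e \<le> 1" if "e \<in># proots (char_poly A)" for e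
    using that A0 eigenvalue_root_char_poly[OF A] symmetric_stochastic_eigenvalue_le_1[OF ss A] by simp
  have "\<mu> \<in># proots (char_poly A)" using sub by (auto dest: mset_subset_eqD)
  then have "\<mu> \<le> 1" by (rule root_le)
  then have ge: "\<mu> \<le> nth_eigenvalue 2 A"
    unfolding nth_eigenvalue_def eigenvalues_desc_def
    using nth_1_rev_sorted_list_of_multiset_ge[OF sub] by simp
  \<comment> \<open>The list is long enough for index 1 to denote a genuine root.\<close>
  have "2 \<le> size (proots (char_poly A))" using size_mset_mono[OF sub] by simp
  then have "1 < length (eigenvalues_desc A)"
    by (metis Suc_1 Suc_le_eq eigenvalues_desc_def length_rev mset_sorted_list_of_multiset size_mset)
  then have "eigenvalues_desc A ! 1 \<in> set (eigenvalues_desc A)" by (rule nth_mem)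
  then have "nth_eigenvalue 2 A \<in># proots (char_poly A)"
    by (simp add: nth_eigenvalue_def eigenvalues_desc_def)
  then show "nth_eigenvalue 2 A \<le> 1" by (rule root_le)
  assume w: "(\<Sum>i<n. w i) = 0"
  have "\<mu> * (\<Sum>i<n. (w i)\<^sup>2) \<le> nth_eigenvalue 2 A * (\<Sum>i<n. (w i)\<^sup>2)"
    using ge by (intro mult_right_mono sum_nonneg) auto
  with bound[OF w] show "(\<Sum>i<n. \<Sum>j<n. A $$ (i, j) * w i * w j) \<le> nth_eigenvalue 2 A * (\<Sum>i<n. (w i)\<^sup>2)"
    by simp
qed

section \<open>The nonlinear spectral gap of \<open>l\<^sub>p\<close>\<close>

text \<open>On the face \<open>z k = R\<close> of a large cube every summand is nonpositive, on \<open>z k = - R\<close> nonnegative.\<close>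

lemma mazur_map_center:
  fixes x :: "nat \<Rightarrow> nat \<Rightarrow> real"
  assumes p: "p \<ge> 2"
  obtains z where "\<And>k. k < N \<Longrightarrow> (\<Sum>i<n. mazur_map p N (\<lambda>k. x i k - z k) k) = 0"
proof -
  \<comment> \<open>\<open>R\<close> dominates every coordinate, which fixes the signs on the faces;
    the summand 1 makes it positive.\<close>
  define R where "R = 1 + (\<Sum>i<n. \<Sum>k<N. \<bar>x i k\<bar>)"
  have xR: "\<bar>x i k\<bar> \<le> R" if "i < n" "k < N" for i k
  proof -
    have "\<bar>x i k\<bar> \<le> (\<Sum>k<N. \<bar>x i k\<bar>)" using that by (intro member_le_sum) auto
    also have "\<dots> \<le> (\<Sum>i<n. \<Sum>k<N. \<bar>x i k\<bar>)"
      using that by (intro member_le_sum[of i _ "\<lambda>i. \<Sum>k<N. \<bar>x i k\<bar>"] sum_nonneg) auto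
    finally show ?thesis by (simp add: R_def)
  qed
  have "R > 0" by (simp add: R_def add_pos_nonneg sum_nonneg)
  then show ?thesis
  proof (rule Poincare_Miranda[of R N "\<lambda>z k. \<Sum>i<n. mazur_map p N (\<lambda>k. x i k - z k) k"])
    fix \<zeta> :: "nat \<Rightarrow> nat \<Rightarrow> real" and z :: "nat \<Rightarrow> real" and k assume k: "k < N" and lim: "\<And>j. j < N \<Longrightarrow> (\<lambda>m. \<zeta> m j) \<longlonglongrightarrow> z j"
    \<comment> \<open>Continuity follows from the Lipschitz bound, since convergence of the first
      \<open>N\<close> coordinates implies convergence in \<open>lp_norm_upto\<close>.\<close>
    have "(\<lambda>m. mazur_map p N (\<lambda>k. x i k - \<zeta> m k) k) \<longlonglongrightarrow> mazur_map p N (\<lambda>k. x i k - z k) k" for i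
    proof (rule LIM_zero_cancel, rule Lim_null_comparison)
      show "\<forall>\<^sub>F m in sequentially. norm (mazur_map p N (\<lambda>k. x i k - \<zeta> m k) k - mazur_map p N (\<lambda>k. x i k - z k) k)
          \<le> 3 * p / 2 * lp_norm_upto p N (\<lambda>k. \<zeta> m k - z k)"
      proof (rule always_eventually, rule allI)
        fix m
        let ?f = "\<lambda>k. mazur_map p N (\<lambda>k. x i k - \<zeta> m k) k - mazur_map p N (\<lambda>k. x i k - z k) k"
        have "(?f k)\<^sup>2 \<le> (\<Sum>k<N. (?f k)\<^sup>2)"
          using k by (intro member_le_sum[of k "{..<N}" "\<lambda>k. (?f k)\<^sup>2"]) auto
        also have "\<dots> \<le> (3 * p / 2 * lp_norm_upto p N (\<lambda>k. (x i k - \<zeta> m k) - (x i k - z k)))\<^sup>2"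
          using p by (rule mazur_map_lipschitz)
        also have "(\<lambda>k. (x i k - \<zeta> m k) - (x i k - z k)) = (\<lambda>k. z k - \<zeta> m k)" by auto
        also have "lp_norm_upto p N \<dots> = lp_norm_upto p N (\<lambda>k. \<zeta> m k - z k)"
          by (rule lp_norm_upto_minus_commute)
        finally have "\<bar>?f k\<bar> \<le> \<bar>3 * p / 2 * lp_norm_upto p N (\<lambda>k. \<zeta> m k - z k)\<bar>"
          by (simp only: abs_le_square_iff)
        then show "norm (?f k) \<le> 3 * p / 2 * lp_norm_upto p N (\<lambda>k. \<zeta> m k - z k)"
          using p by (simp add: abs_mult)
      qed
      have "(\<lambda>m. \<Sum>k<N. \<bar>\<zeta> m k - z k\<bar> powr p) \<longlonglongrightarrow> (\<Sum>k<N. 0)"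
      proof (intro tendsto_sum tendsto_zero_powrI[OF _ tendsto_const])
        fix j assume "j \<in> {..<N}"
        then show "(\<lambda>m. \<bar>\<zeta> m j - z j\<bar>) \<longlonglongrightarrow> 0"
          using lim by (intro tendsto_rabs_zero LIM_zero) auto
      qed (use p in auto)
      then have "(\<lambda>m. lp_norm_upto p N (\<lambda>k. \<zeta> m k - z k)) \<longlonglongrightarrow> 0"
        unfolding lp_norm_upto_def
        using p by (intro tendsto_zero_powrI[OF _ tendsto_const]) (auto simp: sum_nonneg)
      then show "(\<lambda>m. 3 * p / 2 * lp_norm_upto p N (\<lambda>k. \<zeta> m k - z k)) \<longlonglongrightarrow> 0"
        by (rule tendsto_mult_right_zero)
    qed
    then show "(\<lambda>m. \<Sum>i<n. mazur_map p N (\<lambda>k. x i k - \<zeta> m k) k)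
        \<longlonglongrightarrow> (\<Sum>i<n. mazur_map p N (\<lambda>k. x i k - z k) k)"
      by (intro tendsto_sum)
  next
    fix z :: "nat \<Rightarrow> real" and k assume k: "k < N" and "z k = - R"
    then have "x i k - z k \<ge> 0" if "i < n" for i using xR[OF that k] by (simp add: abs_le_iff)
    then show "(\<Sum>i<n. mazur_map p N (\<lambda>k. x i k - z k) k) \<ge> 0"
      by (intro sum_nonneg) (simp add: mazur_map_def)
  next
    fix z :: "nat \<Rightarrow> real" and k assume k: "k < N" and "z k = R"
    then have "x i k - z k \<le> 0" if "i < n" for i using xR[OF that k] by (simp add: abs_le_iff)
    then show "(\<Sum>i<n. mazur_map p N (\<lambda>k. x i k - z k) k) \<le> 0"
      by (intro sum_nonpos) (simp add: mazur_map_def mult_nonneg_nonpos mult_nonpos_nonneg)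
  qed (use that in blast)
qed

text \<open>The constant collects \<open>4 * n\<close> from the triangle inequality through
  \<open>z\<close>, \<open>1 / (2 * \<delta>)\<close> from the Hilbert space gap and
  \<open>(3 * p / 2)\<^sup>2\<close> from the Mazur map.\<close>

lemma spectral_gap_lp_norm_upto:
  assumes p: "p \<ge> 2" and n: "n \<ge> 2" and A: "A \<in> carrier_mat n n" and ss: "symmetric_stochastic A"
    and gap: "nth_eigenvalue 2 A < 1"
  shows "(\<Sum>i<n. \<Sum>j<n. (lp_norm_upto p N (\<lambda>k. x i k - x j k))\<^sup>2)
    \<le> real n * (9 / 2 * p\<^sup>2 / (1 - nth_eigenvalue 2 A))
      * (\<Sum>i<n. \<Sum>j<n. A $$ (i, j) * (lp_norm_upto p N (\<lambda>k. x i k - x j k))\<^sup>2)"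
proof -
  note D = symmetric_stochasticD[OF ss A]
  define \<delta> where "\<delta> = 1 - nth_eigenvalue 2 A"
  have \<delta>: "\<delta> > 0" using gap by (simp add: \<delta>_def)
  define E where "E = (\<Sum>i<n. \<Sum>j<n. A $$ (i, j) * (lp_norm_upto p N (\<lambda>k. x i k - x j k))\<^sup>2)"
  obtain z where z: "\<And>k. k < N \<Longrightarrow> (\<Sum>i<n. mazur_map p N (\<lambda>k. x i k - z k) k) = 0"
    using mazur_map_center[OF p] by metis
  define y where "y i k = mazur_map p N (\<lambda>k. x i k - z k) k" for i k
  define S where "S = (\<Sum>i<n. (lp_norm_upto p N (\<lambda>k. x i k - z k))\<^sup>2)"
  have "(\<Sum>i<n. \<Sum>j<n. (lp_norm_upto p N (\<lambda>k. x i k - x j k))\<^sup>2)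
      \<le> (\<Sum>i<n. \<Sum>j<n. 2 * (lp_norm_upto p N (\<lambda>k. x i k - z k))\<^sup>2 + 2 * (lp_norm_upto p N (\<lambda>k. x j k - z k))\<^sup>2)"
  proof (intro sum_mono)
    fix i j
    let ?a = "lp_norm_upto p N (\<lambda>k. x i k - z k)" and ?b = "lp_norm_upto p N (\<lambda>k. x j k - z k)"
    have "lp_norm_upto p N (\<lambda>k. x i k - x j k) \<le> ?a + ?b"
      using lp_norm_upto_triangle[of p N "\<lambda>k. x i k - z k" "\<lambda>k. z k - x j k"] p
      by (simp add: lp_norm_upto_minus_commute[of p N z])
    then have "(lp_norm_upto p N (\<lambda>k. x i k - x j k))\<^sup>2 \<le> (?a + ?b)\<^sup>2"
      by (intro power_mono) auto
    also have "\<dots> \<le> 2 * ?a\<^sup>2 + 2 * ?b\<^sup>2"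
      using sum_squares_ge_zero[of "?a - ?b" 0] by (simp add: power2_eq_square algebra_simps)
    finally show "(lp_norm_upto p N (\<lambda>k. x i k - x j k))\<^sup>2 \<le> 2 * ?a\<^sup>2 + 2 * ?b\<^sup>2" .
  qed
  also have "\<dots> = 4 * real n * S"
    by (simp add: S_def sum.distrib sum_distrib_left mult.assoc)
  finally have upper: "(\<Sum>i<n. \<Sum>j<n. (lp_norm_upto p N (\<lambda>k. x i k - x j k))\<^sup>2) \<le> 4 * real n * S" .
  define F where "F = (\<Sum>k<N. \<Sum>i<n. \<Sum>j<n. A $$ (i, j) * (y i k - y j k)\<^sup>2)"
  have "S = (\<Sum>i<n. \<Sum>k<N. (y i k)\<^sup>2)"
    using p by (simp add: S_def y_def sum_mazur_map_squared)
  also have "\<dots> = (\<Sum>k<N. \<Sum>i<n. (y i k)\<^sup>2)" by (rule sum.swap)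
  also have "\<dots> \<le> (\<Sum>k<N. (\<Sum>i<n. \<Sum>j<n. A $$ (i, j) * (y i k - y j k)\<^sup>2) / (2 * \<delta>))"
  proof (intro sum_mono)
    fix k assume "k \<in> {..<N}"
    then have "(\<Sum>i<n. y i k) = 0" using z by (simp add: y_def)
    \<comment> \<open>Coordinatewise, the Dirichlet form is at least \<open>2 * \<delta>\<close>
      times the squared norm. The Hilbert space inequality is the sum over coordinates.\<close>
    from symmetric_stochastic_second_eigenvalue(2)[OF n A ss this]
    have "2 * \<delta> * (\<Sum>i<n. (y i k)\<^sup>2) \<le> (\<Sum>i<n. \<Sum>j<n. A $$ (i, j) * (y i k - y j k)\<^sup>2)"
      using stochastic_dirichlet_form[of n "\<lambda>i j. A $$ (i, j)" "\<lambda>i. y i k"] D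
      by (simp add: \<delta>_def algebra_simps)
    then show "(\<Sum>i<n. (y i k)\<^sup>2) \<le> (\<Sum>i<n. \<Sum>j<n. A $$ (i, j) * (y i k - y j k)\<^sup>2) / (2 * \<delta>)"
      using \<delta> by (simp add: pos_le_divide_eq mult_ac)
  qed
  also have "\<dots> = F / (2 * \<delta>)"
    by (simp add: F_def sum_divide_distrib)
  finally have S_le: "S \<le> F / (2 * \<delta>)" .
  have "F = (\<Sum>i<n. \<Sum>j<n. A $$ (i, j) * (\<Sum>k<N. (y i k - y j k)\<^sup>2))"
    unfolding F_def by (subst sum.swap, rule sum.cong[OF refl], subst sum.swap) (simp add: sum_distrib_left)
  also have "\<dots> \<le> (\<Sum>i<n. \<Sum>j<n. A $$ (i, j) * (3 * p / 2 * lp_norm_upto p N (\<lambda>k. x i k - x j k))\<^sup>2)"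
  proof (intro sum_mono mult_left_mono)
    fix i j
    show "(\<Sum>k<N. (y i k - y j k)\<^sup>2) \<le> (3 * p / 2 * lp_norm_upto p N (\<lambda>k. x i k - x j k))\<^sup>2"
      \<comment> \<open>The common shift by \<open>z\<close> cancels in the difference of the
        arguments.\<close>
      using mazur_map_lipschitz[OF p, of N "\<lambda>k. x i k - z k" "\<lambda>k. x j k - z k"] by (simp add: y_def)
  qed (use D in auto)
  also have "\<dots> = 9 / 4 * p\<^sup>2 * E"
    by (simp add: E_def sum_distrib_left power_mult_distrib power_divide mult_ac)
  finally have "F / (2 * \<delta>) \<le> 9 / 4 * p\<^sup>2 * E / (2 * \<delta>)"
    using \<delta> by (intro divide_right_mono) auto
  with S_le have "4 * real n * S \<le> 4 * real n * (9 / 4 * p\<^sup>2 * E / (2 * \<delta>))"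
    by (intro mult_left_mono) auto
  also have "\<dots> = real n * (9 / 2 * p\<^sup>2 / \<delta>) * E" by simp
  finally show ?thesis using upper by (simp add: E_def \<delta>_def)
qed

section \<open>Passage to infinite sequences\<close>

lemma lp_space_diff:
  assumes p: "p > 0" and x: "x \<in> lp_space p" and y: "y \<in> lp_space p"
  shows "(\<lambda>k. x k - y k) \<in> lp_space p"
proof -
  have le: "\<bar>x k - y k\<bar> powr p \<le> 2 powr p * (\<bar>x k\<bar> powr p + \<bar>y k\<bar> powr p)" for k
  proof -
    have "\<bar>x k - y k\<bar> powr p \<le> (2 * max \<bar>x k\<bar> \<bar>y k\<bar>) powr p" using p by (intro powr_mono2) auto
    also have "\<dots> = 2 powr p * (max \<bar>x k\<bar> \<bar>y k\<bar>) powr p" by (simp add: powr_mult)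
    also have "\<dots> \<le> 2 powr p * (\<bar>x k\<bar> powr p + \<bar>y k\<bar> powr p)"
      by (intro mult_left_mono) (auto simp: max_def)
    finally show ?thesis .
  qed
  have "summable (\<lambda>k. 2 powr p * (\<bar>x k\<bar> powr p + \<bar>y k\<bar> powr p))"
    using x y by (intro summable_mult summable_add) (auto simp: lp_space_def)
  then have "summable (\<lambda>k. \<bar>x k - y k\<bar> powr p)"
    by (rule summable_comparison_test'[where N = 0]) (simp add: le)
  then show ?thesis by (simp add: lp_space_def)
qed

lemma lp_norm_upto_tendsto_lp_norm:
  assumes "p > 0" "x \<in> lp_space p"
  shows "(\<lambda>N. lp_norm_upto p N x) \<longlonglongrightarrow> lp_norm p x"
  unfolding lp_norm_upto_def lp_norm_def
  using assms by (intro tendsto_powr' summable_LIMSEQ) (auto simp: lp_space_def sum_nonneg)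

text \<open>The constant is independent of the number \<open>N\<close> of coordinates, so both sides
  pass to the limit, although the centre \<open>z\<close> may change with \<open>N\<close>.\<close>

lemma spectral_gap_lp_norm:
  assumes p: "p \<ge> 2" and n: "n \<ge> 2" and A: "A \<in> carrier_mat n n" and ss: "symmetric_stochastic A"
    and gap: "nth_eigenvalue 2 A < 1" and x: "\<forall>i<n. x i \<in> lp_space p"
  shows "(\<Sum>i<n. \<Sum>j<n. (lp_norm p (\<lambda>k. x i k - x j k))\<^sup>2)
    \<le> real n * (9 / 2 * p\<^sup>2 / (1 - nth_eigenvalue 2 A))
      * (\<Sum>i<n. \<Sum>j<n. A $$ (i, j) * (lp_norm p (\<lambda>k. x i k - x j k))\<^sup>2)"
proof (rule LIMSEQ_le)
  have lim: "(\<lambda>N. lp_norm_upto p N (\<lambda>k. x i k - x j k)) \<longlonglongrightarrow> lp_norm p (\<lambda>k. x i k - x j k)"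
    if "i < n" "j < n" for i j
    using that p x by (intro lp_norm_upto_tendsto_lp_norm lp_space_diff) auto
  show "(\<lambda>N. \<Sum>i<n. \<Sum>j<n. (lp_norm_upto p N (\<lambda>k. x i k - x j k))\<^sup>2)
      \<longlonglongrightarrow> (\<Sum>i<n. \<Sum>j<n. (lp_norm p (\<lambda>k. x i k - x j k))\<^sup>2)"
    by (intro tendsto_sum tendsto_power lim) auto
  show "(\<lambda>N. real n * (9 / 2 * p\<^sup>2 / (1 - nth_eigenvalue 2 A))
        * (\<Sum>i<n. \<Sum>j<n. A $$ (i, j) * (lp_norm_upto p N (\<lambda>k. x i k - x j k))\<^sup>2))
      \<longlonglongrightarrow> real n * (9 / 2 * p\<^sup>2 / (1 - nth_eigenvalue 2 A))
        * (\<Sum>i<n. \<Sum>j<n. A $$ (i, j) * (lp_norm p (\<lambda>k. x i k - x j k))\<^sup>2)"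
    by (intro tendsto_sum tendsto_power tendsto_mult tendsto_const lim) auto
qed (use spectral_gap_lp_norm_upto[OF p n A ss gap] in blast)

theorem theorem1p5:
  shows "\<exists>C::real. C > 0 \<and>
    (\<forall>p::real. p \<ge> 2 \<longrightarrow>
      (\<forall>n::nat. n \<ge> 2 \<longrightarrow>
        (\<forall>A \<in> carrier_mat n n. symmetric_stochastic A \<longrightarrow>
           gamma_lp_sq A p \<le>
             (if nth_eigenvalue 2 A = 1 then \<infinity>
              else ereal (C * p\<^sup>2 / (1 - nth_eigenvalue 2 A))))))"
proof (intro exI[of _ "9 / 2"] conjI allI impI ballI)
  fix p :: real and n :: nat and A :: "real mat"
  assume p: "p \<ge> 2" and n: "n \<ge> 2" and A: "A \<in> carrier_mat n n" and ss: "symmetric_stochastic A"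
  define \<gamma> where "\<gamma> = 9 / 2 * p\<^sup>2 / (1 - nth_eigenvalue 2 A)"
  have "gamma_lp_sq A p \<le> ereal \<gamma>" if "nth_eigenvalue 2 A \<noteq> 1"
  proof -
    \<comment> \<open>The bound \<open>nth_eigenvalue 2 A \<le> 1\<close> turns the excluded
      equality into a strict gap.\<close>
    have gap: "nth_eigenvalue 2 A < 1"
      using symmetric_stochastic_second_eigenvalue(1)[OF n A ss] that by simp
    have "\<gamma> > 0" using gap p by (simp add: \<gamma>_def)
    moreover have "1 / (real n)\<^sup>2 * (\<Sum>i<n. \<Sum>j<n. (lp_norm p (\<lambda>k. x i k - x j k))\<^sup>2)
        \<le> \<gamma> / real n * (\<Sum>i<n. \<Sum>j<n. A $$ (i, j) * (lp_norm p (\<lambda>k. x i k - x j k))\<^sup>2)"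
      if "\<forall>i<n. x i \<in> lp_space p" for x
    proof -
      have "1 / (real n)\<^sup>2 * (\<Sum>i<n. \<Sum>j<n. (lp_norm p (\<lambda>k. x i k - x j k))\<^sup>2)
          \<le> 1 / (real n)\<^sup>2 * (real n * \<gamma> * (\<Sum>i<n. \<Sum>j<n. A $$ (i, j) * (lp_norm p (\<lambda>k. x i k - x j k))\<^sup>2))"
        unfolding \<gamma>_def by (intro mult_left_mono spectral_gap_lp_norm[OF p n A ss gap that]) simp
      then show ?thesis using n by (simp add: power2_eq_square)
    qed
    \<comment> \<open>\<open>\<gamma>\<close> is itself an admissible constant, hence bounds the
      infimum from above.\<close>
    ultimately show ?thesis
      unfolding gamma_lp_sq_def poincare_const_def Let_def
      using A by (intro Inf_lower) auto
  qed
  then show "gamma_lp_sq A p \<le> (if nth_eigenvalue 2 A = 1 then \<infinity>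
      else ereal (9 / 2 * p\<^sup>2 / (1 - nth_eigenvalue 2 A)))"
    by (simp add: \<gamma>_def)
qed simp

end
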